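(* Let $r\ge 0$ and let $S\subseteq\{0,1,\ldots,r\}$ be a subset containing $r$. The unit $R_{(0)}^0$ of the monoidal structure on $f\mathcal{C}$ is not cofibrant in $(f\mathcal{C})_S$.
   Context: Fix a commutative unital ring $R$. $f\mathcal{C}$ is the category of filtered chain complexes: an object is an unbounded, cohomologically graded chain complex $A$ of $R$-modules (differential $d$ of degree $+1$) with subcomplexes $F_pA$, $p\in\mathbb{Z}$, such that $F_pA\subseteq F_{p+1}A\subseteq A$; a morphism is a chain map $f\colon A\to B$ with $f(F_pA)\subseteq F_pB$ for all $p$. For $k\ge 0$ put $Z_k^{p,p+n}(A)=F_pA^n\cap d^{-1}F_{p-k}A^{n+1}$, $B_0^{p,p+n}(A)=F_{p-1}A^n$, and for $k\ge1$, $B_k^{p,p+n}(A)=d\,Z_{k-1}^{p+k-1,p+k-1+n-1}(A)+Z_{k-1}^{p-1,p-1+n}(A)$. The $k$-page of the associated spectral sequence is $E_k^{p,p+n}(A)=Z_k^{p,p+n}(A)/B_k^{p,p+n}(A)$. An $r$-quasi-isomorphism is a morphism inducing an isomorphism on $E_{r+1}$. $R_{(p)}^n$ is the filtered chain complex with a copy of $R$ in degree $n$ and $0$ elsewhere, with $F_q=0$ for $q<p$ and $F_q=R$ in degree $n$ for $q\ge p$. Set $\mathcal{Z}_k(p,n)=\bigl(R_{(p)}^n\xrightarrow{1}R_{(p-k)}^{n+1}\bigr)$, and for $k\ge 1$, $\mathcal{B}_k(p,n)=\mathcal{Z}_{k-1}(p+k-1,n-1)\oplus\mathcal{Z}_{k-1}(p-1,n)$,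 with $\varphi_k\colon\mathcal{Z}_k(p,n)\to\mathcal{B}_k(p,n)$ the diagonal $R_{(p)}^n\to R_{(p)}^n\oplus R_{(p-1)}^n$ in degree $n$ and the identity in degree $n+1$. Let $I_r=\{\varphi_{r+1}\colon\mathcal{Z}_{r+1}(p,n)\to\mathcal{B}_{r+1}(p,n)\}_{p,n\in\mathbb{Z}}$, $J_k=\{0\to\mathcal{Z}_k(p,n)\}_{p,n\in\mathbb{Z}}$, $I_S=I_r\cup\bigcup_{s\in S}J_s$, $J_S=\bigcup_{s\in S}J_s$. $(f\mathcal{C})_S$ is the cofibrantly generated model structure on $f\mathcal{C}$ with weak equivalences the $r$-quasi-isomorphisms, generating cofibrations $I_S$ and generating acyclic cofibrations $J_S$. The monoidal product is the usual tensor product of complexes with $F_p(A\otimes B)=\sum_i\operatorname{im}(F_iA\otimes F_{p-i}B\to A\otimes B)$.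
   Formalization: The commutative unital ring R is assumed to be nonzero (1 ≠ 0); over the zero ring the unit is the zero complex, hence initial and cofibrant, so the claim fails there. *)

theory Defs
  imports "HOL-Algebra.Module" "HOL-Algebra.AbelCoset"
begin

section \<open>Filtered chain complexes\<close>

text \<open>
  Modules are those of HOL-Algebra; the \<open>mult\<close> and \<open>one\<close> fields of a module record carry no
  meaning. Functions between modules are only meaningful on carriers, so all equations between
  maps are stated on carriers.
\<close>

definition mod_hom :: "'r ring \<Rightarrow> ('r, 'm) module \<Rightarrow> ('r, 'n) module \<Rightarrow> ('m \<Rightarrow> 'n) set" where
  "mod_hom R M N = {f. f \<in> carrier M \<rightarrow> carrier N \<and>
     (\<forall>x\<in>carrier M. \<forall>y\<in>carrier M. f (x \<oplus>\<^bsub>M\<^esub> y) = f x \<oplus>\<^bsub>N\<^esub> f y) \<and>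
     (\<forall>a\<in>carrier R. \<forall>x\<in>carrier M. f (a \<odot>\<^bsub>M\<^esub> x) = a \<odot>\<^bsub>N\<^esub> f x)}"

definition mod_iso :: "'r ring \<Rightarrow> ('r, 'm) module \<Rightarrow> ('r, 'n) module \<Rightarrow> ('m \<Rightarrow> 'n) set" where
  "mod_iso R M N = {f \<in> mod_hom R M N. bij_betw f (carrier M) (carrier N)}"

text \<open>\<open>filt A p n\<close> is $F_p A^n$.\<close>

record ('r, 'm) fcomplex =
  cmod :: "int \<Rightarrow> ('r, 'm) module"
  diff :: "int \<Rightarrow> 'm \<Rightarrow> 'm"
  filt :: "int \<Rightarrow> int \<Rightarrow> 'm set"

definition is_fcomplex :: "'r ring \<Rightarrow> ('r, 'm) fcomplex \<Rightarrow> bool" where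
  "is_fcomplex R A \<longleftrightarrow>
     (\<forall>n. module R (cmod A n)) \<and>
     (\<forall>n. diff A n \<in> mod_hom R (cmod A n) (cmod A (n + 1))) \<and>
     (\<forall>n. \<forall>x\<in>carrier (cmod A n). diff A (n + 1) (diff A n x) = \<zero>\<^bsub>cmod A (n + 2)\<^esub>) \<and>
     (\<forall>p n. submodule (filt A p n) R (cmod A n)) \<and>
     (\<forall>p n. diff A n ` filt A p n \<subseteq> filt A p (n + 1)) \<and>
     (\<forall>p n. filt A p n \<subseteq> filt A (p + 1) n)"

record ('r, 'm) fmor =
  src :: "('r, 'm) fcomplex"
  tgt :: "('r, 'm) fcomplex"
  fn :: "int \<Rightarrow> 'm \<Rightarrow> 'm"

definition arr :: "'r ring \<Rightarrow> ('r, 'm) fmor set" where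
  "arr R = {f. is_fcomplex R (src f) \<and> is_fcomplex R (tgt f) \<and>
     (\<forall>n. fn f n \<in> mod_hom R (cmod (src f) n) (cmod (tgt f) n)) \<and>
     (\<forall>n. \<forall>x\<in>carrier (cmod (src f) n).
        fn f (n + 1) (diff (src f) n x) = diff (tgt f) n (fn f n x)) \<and>
     (\<forall>p n. fn f n ` filt (src f) p n \<subseteq> filt (tgt f) p n)}"


section \<open>The spectral sequence and \<open>r\<close>-quasi-isomorphisms\<close>

text \<open>
  \<open>cyc A k p n\<close>, \<open>bnd A k p n\<close> and \<open>page A k p n\<close> are $Z_k^{p,p+n}(A)$, $B_k^{p,p+n}(A)$ and
  $E_k^{p,p+n}(A)$; in particular the last index is the cohomological degree.
\<close>

definition cyc :: "('r, 'm) fcomplex \<Rightarrow> nat \<Rightarrow> int \<Rightarrow> int \<Rightarrow> 'm set" where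
  "cyc A k p n = {x \<in> filt A p n. diff A n x \<in> filt A (p - int k) (n + 1)}"

fun bnd :: "('r, 'm) fcomplex \<Rightarrow> nat \<Rightarrow> int \<Rightarrow> int \<Rightarrow> 'm set" where
  "bnd A 0 p n = filt A (p - 1) n"
| "bnd A (Suc j) p n =
     (diff A (n - 1) ` cyc A j (p + int j) (n - 1)) <+>\<^bsub>cmod A n\<^esub> cyc A j (p - 1) n"

definition quot_module :: "('r, 'm) module \<Rightarrow> 'm set \<Rightarrow> 'm set \<Rightarrow> ('r, 'm set) module" where
  "quot_module M Z B =
     \<lparr>carrier = (\<lambda>z. B +>\<^bsub>M\<^esub> z) ` Z, mult = (\<lambda>_ _. B), one = B,
      zero = B, add = (\<lambda>X Y. X <+>\<^bsub>M\<^esub> Y),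
      smult = (\<lambda>a X. \<Union>x\<in>X. B +>\<^bsub>M\<^esub> (a \<odot>\<^bsub>M\<^esub> x))\<rparr>"

definition page :: "('r, 'm) fcomplex \<Rightarrow> nat \<Rightarrow> int \<Rightarrow> int \<Rightarrow> ('r, 'm set) module" where
  "page A k p n = quot_module (cmod A n) (cyc A k p n) (bnd A k p n)"

text \<open>The union ranges over all representatives \<open>x\<close> of the coset \<open>X\<close>; they all give the same coset.\<close>

definition page_map :: "('r, 'm) fmor \<Rightarrow> nat \<Rightarrow> int \<Rightarrow> int \<Rightarrow> 'm set \<Rightarrow> 'm set" where
  "page_map f k p n X = (\<Union>x\<in>X. bnd (tgt f) k p n +>\<^bsub>cmod (tgt f) n\<^esub> fn f n x)"

definition quasi_isos :: "'r ring \<Rightarrow> nat \<Rightarrow> ('r, 'm) fmor set" where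
  "quasi_isos R r = {f \<in> arr R. \<forall>p n.
     page_map f (r + 1) p n \<in> mod_iso R (page (src f) (r + 1) p n) (page (tgt f) (r + 1) p n)}"


section \<open>Lifting properties\<close>

definition has_lift :: "'r ring \<Rightarrow> ('r, 'm) fmor \<Rightarrow> ('r, 'm) fmor \<Rightarrow> bool" where
  "has_lift R i f \<longleftrightarrow> (\<forall>u\<in>arr R. \<forall>v\<in>arr R.
     src u = src i \<and> tgt u = src f \<and> src v = tgt i \<and> tgt v = tgt f \<and>
     (\<forall>n. \<forall>x\<in>carrier (cmod (src i) n). fn f n (fn u n x) = fn v n (fn i n x)) \<longrightarrow>
     (\<exists>h\<in>arr R. src h = tgt i \<and> tgt h = src f \<and>
        (\<forall>n. \<forall>x\<in>carrier (cmod (src i) n). fn h n (fn i n x) = fn u n x) \<and>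
        (\<forall>n. \<forall>y\<in>carrier (cmod (tgt i) n). fn f n (fn h n y) = fn v n y)))"

definition llp :: "'r ring \<Rightarrow> ('r, 'm) fmor set \<Rightarrow> ('r, 'm) fmor set" where
  "llp R K = {i \<in> arr R. \<forall>f\<in>K. has_lift R i f}"

definition rlp :: "'r ring \<Rightarrow> ('r, 'm) fmor set \<Rightarrow> ('r, 'm) fmor set" where
  "rlp R K = {f \<in> arr R. \<forall>i\<in>K. has_lift R i f}"


section \<open>A universe of elements\<close>

text \<open>
  The carriers of all filtered complexes in one instance of the category are subsets of one type.
  This type contains a copy of the ring, is closed under pairing (hence infinite, and the category
  has binary direct sums on the nose), and has an arbitrary type \<open>'x\<close> of further elements. So every
  filtered complex of \<open>R\<close>-modules, with elements in whatever type, occurs in the category for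
  a suitable \<open>'x\<close>.
\<close>

datatype ('r, 'x) elt =
    Scal (the_scal: 'r)
  | Atom 'x
  | Couple (pfst: "('r, 'x) elt") (psnd: "('r, 'x) elt")

definition reg_module :: "'r ring \<Rightarrow> ('r, ('r, 'x) elt) module" where
  "reg_module R =
     \<lparr>carrier = Scal ` carrier R,
      mult = (\<lambda>x y. Scal (the_scal x \<otimes>\<^bsub>R\<^esub> the_scal y)), one = Scal \<one>\<^bsub>R\<^esub>,
      zero = Scal \<zero>\<^bsub>R\<^esub>, add = (\<lambda>x y. Scal (the_scal x \<oplus>\<^bsub>R\<^esub> the_scal y)),
      smult = (\<lambda>a x. Scal (a \<otimes>\<^bsub>R\<^esub> the_scal x))\<rparr>"

definition zero_module :: "'r ring \<Rightarrow> ('r, ('r, 'x) elt) module" where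
  "zero_module R = reg_module R \<lparr>carrier := {Scal \<zero>\<^bsub>R\<^esub>}\<rparr>"

definition sum_module ::
  "('r, ('r, 'x) elt) module \<Rightarrow> ('r, ('r, 'x) elt) module \<Rightarrow> ('r, ('r, 'x) elt) module" where
  "sum_module M N =
     \<lparr>carrier = {Couple x y | x y. x \<in> carrier M \<and> y \<in> carrier N},
      mult = (\<lambda>u v. Couple (pfst u \<otimes>\<^bsub>M\<^esub> pfst v) (psnd u \<otimes>\<^bsub>N\<^esub> psnd v)),
      one = Couple \<one>\<^bsub>M\<^esub> \<one>\<^bsub>N\<^esub>, zero = Couple \<zero>\<^bsub>M\<^esub> \<zero>\<^bsub>N\<^esub>,
      add = (\<lambda>u v. Couple (pfst u \<oplus>\<^bsub>M\<^esub> pfst v) (psnd u \<oplus>\<^bsub>N\<^esub> psnd v)),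
      smult = (\<lambda>a u. Couple (a \<odot>\<^bsub>M\<^esub> pfst u) (a \<odot>\<^bsub>N\<^esub> psnd u))\<rparr>"


section \<open>The representing complexes\<close>

definition zero_fc :: "'r ring \<Rightarrow> ('r, ('r, 'x) elt) fcomplex" where
  "zero_fc R = \<lparr>cmod = (\<lambda>_. zero_module R), diff = (\<lambda>_ _. Scal \<zero>\<^bsub>R\<^esub>), filt = (\<lambda>_ _. {Scal \<zero>\<^bsub>R\<^esub>})\<rparr>"

definition initial_map :: "'r ring \<Rightarrow> ('r, ('r, 'x) elt) fcomplex \<Rightarrow> ('r, ('r, 'x) elt) fmor" where
  "initial_map R X = \<lparr>src = zero_fc R, tgt = X, fn = (\<lambda>n _. \<zero>\<^bsub>cmod X n\<^esub>)\<rparr>"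

text \<open>\<open>R_fc R p n\<close> is $R_{(p)}^n$.\<close>

definition R_fc :: "'r ring \<Rightarrow> int \<Rightarrow> int \<Rightarrow> ('r, ('r, 'x) elt) fcomplex" where
  "R_fc R p n =
     \<lparr>cmod = (\<lambda>m. if m = n then reg_module R else zero_module R),
      diff = (\<lambda>_ _. Scal \<zero>\<^bsub>R\<^esub>),
      filt = (\<lambda>q m. if m = n \<and> p \<le> q then Scal ` carrier R else {Scal \<zero>\<^bsub>R\<^esub>})\<rparr>"

text \<open>\<open>Z_fc R k p n\<close> is $\mathcal{Z}_k(p,n)$.\<close>

definition Z_fc :: "'r ring \<Rightarrow> nat \<Rightarrow> int \<Rightarrow> int \<Rightarrow> ('r, ('r, 'x) elt) fcomplex" where
  "Z_fc R k p n =
     \<lparr>cmod = (\<lambda>m. if m = n \<or> m = n + 1 then reg_module R else zero_module R),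
      diff = (\<lambda>m x. if m = n then x else Scal \<zero>\<^bsub>R\<^esub>),
      filt = (\<lambda>q m. if m = n \<and> p \<le> q \<or> m = n + 1 \<and> p - int k \<le> q
                     then Scal ` carrier R else {Scal \<zero>\<^bsub>R\<^esub>})\<rparr>"

definition sum_fc ::
  "('r, ('r, 'x) elt) fcomplex \<Rightarrow> ('r, ('r, 'x) elt) fcomplex \<Rightarrow> ('r, ('r, 'x) elt) fcomplex" where
  "sum_fc A B =
     \<lparr>cmod = (\<lambda>n. sum_module (cmod A n) (cmod B n)),
      diff = (\<lambda>n u. Couple (diff A n (pfst u)) (diff B n (psnd u))),
      filt = (\<lambda>p n. {Couple x y | x y. x \<in> filt A p n \<and> y \<in> filt B p n})\<rparr>"

text \<open>\<open>B_fc R k p n\<close> is $\mathcal{B}_k(p,n)$, meant for \<open>k \<ge> 1\<close> only.\<close>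

definition B_fc :: "'r ring \<Rightarrow> nat \<Rightarrow> int \<Rightarrow> int \<Rightarrow> ('r, ('r, 'x) elt) fcomplex" where
  "B_fc R k p n = sum_fc (Z_fc R (k - 1) (p + int k - 1) (n - 1)) (Z_fc R (k - 1) (p - 1) n)"

text \<open>
  In degree \<open>n + 1\<close> the first summand of $\mathcal{B}_k(p,n)$ vanishes, so that the identity of
  $R_{(p-k)}^{n+1}$ is \<open>x \<mapsto> (0, x)\<close>.
\<close>

definition phi :: "'r ring \<Rightarrow> nat \<Rightarrow> int \<Rightarrow> int \<Rightarrow> ('r, ('r, 'x) elt) fmor" where
  "phi R k p n = \<lparr>src = Z_fc R k p n, tgt = B_fc R k p n,
     fn = (\<lambda>m x. if m = n then Couple x x else Couple (Scal \<zero>\<^bsub>R\<^esub>) x)\<rparr>"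


section \<open>The model structure\<close>

definition I_r :: "'r ring \<Rightarrow> nat \<Rightarrow> ('r, ('r, 'x) elt) fmor set" where
  "I_r R r = {phi R (r + 1) p n | p n. True}"

definition J_k :: "'r ring \<Rightarrow> nat \<Rightarrow> ('r, ('r, 'x) elt) fmor set" where
  "J_k R k = {initial_map R (Z_fc R k p n) | p n. True}"

definition J_S :: "'r ring \<Rightarrow> nat set \<Rightarrow> ('r, ('r, 'x) elt) fmor set" where
  "J_S R S = (\<Union>s\<in>S. J_k R s)"

definition I_S :: "'r ring \<Rightarrow> nat \<Rightarrow> nat set \<Rightarrow> ('r, ('r, 'x) elt) fmor set" where
  "I_S R r S = I_r R r \<union> J_S R S"

record ('r, 'm) model_str =
  weqs :: "('r, 'm) fmor set"
  cofs :: "('r, 'm) fmor set"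
  fibs :: "('r, 'm) fmor set"

text \<open>
  In a model structure cofibrantly generated by \<open>I\<close> and \<open>J\<close> the fibrations are the maps with the
  right lifting property against \<open>J\<close>, the acyclic fibrations are those with the right lifting
  property against \<open>I\<close>, and the cofibrations are the maps with the left lifting property against
  the latter.
\<close>

definition cofib_generated ::
  "'r ring \<Rightarrow> ('r, 'm) fmor set \<Rightarrow> ('r, 'm) fmor set \<Rightarrow> ('r, 'm) fmor set \<Rightarrow> ('r, 'm) model_str" where
  "cofib_generated R W I J = \<lparr>weqs = W, cofs = llp R (rlp R I), fibs = rlp R J\<rparr>"

definition fC_model :: "'r ring \<Rightarrow> nat \<Rightarrow> nat set \<Rightarrow> ('r, ('r, 'x) elt) model_str" where
  "fC_model R r S = cofib_generated R (quasi_isos R r) (I_S R r S) (J_S R S)"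

definition cofibrant ::
  "'r ring \<Rightarrow> ('r, ('r, 'x) elt) model_str \<Rightarrow> ('r, ('r, 'x) elt) fcomplex \<Rightarrow> bool" where
  "cofibrant R M X \<longleftrightarrow> initial_map R X \<in> cofs M"


section \<open>The objects and generating maps above belong to the category\<close>

lemma is_fcomplexI:
  assumes "\<And>n. module R (cmod A n)"
    and "\<And>n. diff A n \<in> mod_hom R (cmod A n) (cmod A (n + 1))"
    and "\<And>n x. x \<in> carrier (cmod A n) \<Longrightarrow> diff A (n + 1) (diff A n x) = \<zero>\<^bsub>cmod A (n + 2)\<^esub>"
    and "\<And>p n. submodule (filt A p n) R (cmod A n)"
    and "\<And>p n x. x \<in> filt A p n \<Longrightarrow> diff A n x \<in> filt A p (n + 1)"
    and "\<And>p n x. x \<in> filt A p n \<Longrightarrow> x \<in> filt A (p + 1) n"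
  shows "is_fcomplex R A"
  unfolding is_fcomplex_def by (intro conjI allI ballI subsetI) (auto intro: assms)

lemma is_fcomplexD:
  assumes "is_fcomplex R A"
  shows "module R (cmod A n)"
    and "diff A n \<in> mod_hom R (cmod A n) (cmod A (n + 1))"
    and "x \<in> carrier (cmod A n) \<Longrightarrow> diff A (n + 1) (diff A n x) = \<zero>\<^bsub>cmod A (n + 2)\<^esub>"
    and "submodule (filt A p n) R (cmod A n)"
    and "x \<in> filt A p n \<Longrightarrow> diff A n x \<in> filt A p (n + 1)"
    and "x \<in> filt A p n \<Longrightarrow> x \<in> filt A (p + 1) n"
  using assms by (simp_all add: is_fcomplex_def image_subset_iff subset_iff)

context
  fixes R :: "'r ring" (structure)
  assumes cring: "cring R"
begin

interpretation cring R by (rule cring)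

lemma module_reg: "module R (reg_module R)"
proof (rule moduleI[OF cring])
  show "abelian_group (reg_module R)"
    by (rule abelian_groupI) (auto simp: reg_module_def a_ac intro: l_neg bexI[of _ "\<ominus> _"])
qed (auto simp: reg_module_def l_distr r_distr m_assoc)

lemma module_zero: "module R (zero_module R)"
proof (rule moduleI[OF cring])
  show "abelian_group (zero_module R)"
    by (rule abelian_groupI) (auto simp: zero_module_def reg_module_def)
qed (auto simp: zero_module_def reg_module_def)

lemma module_sum:
  assumes "module R M" "module R N"
  shows "module R (sum_module M N)"
proof -
  interpret M: module R M by fact
  interpret N: module R N by fact
  show ?thesis
  proof (rule moduleI[OF cring])
    show "abelian_group (sum_module M N)"
    proof (rule abelian_groupI)
      fix x assume "x \<in> carrier (sum_module M N)"
      then obtain a b where "x = Couple a b" "a \<in> carrier M" "b \<in> carrier N"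
        by (auto simp: sum_module_def)
      then show "\<exists>y\<in>carrier (sum_module M N). y \<oplus>\<^bsub>sum_module M N\<^esub> x = \<zero>\<^bsub>sum_module M N\<^esub>"
        by (intro bexI[of _ "Couple (\<ominus>\<^bsub>M\<^esub> a) (\<ominus>\<^bsub>N\<^esub> b)"]) (auto simp: sum_module_def M.l_neg N.l_neg)
    qed (auto simp: sum_module_def M.a_ac N.a_ac)
  qed (auto simp: sum_module_def M.smult_l_distr N.smult_l_distr M.smult_r_distr N.smult_r_distr
      M.smult_assoc1 N.smult_assoc1)
qed

lemma submodule_zero_reg: "submodule {Scal \<zero>} R (reg_module R)"
  by (rule module.submoduleI[OF module_reg])
    (auto simp: reg_module_def a_inv_def m_inv_def intro!: the_equality[symmetric] dest: add.l_cancel_one)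

lemma is_fcomplex_zero: "is_fcomplex R (zero_fc R)"
  using module_zero module.carrier_is_submodule[OF module_zero]
  by (auto simp: is_fcomplex_def zero_fc_def mod_hom_def) (simp_all add: zero_module_def reg_module_def)

lemma submodule_reg:
  "submodule (Scal ` carrier R) R (reg_module R)" "submodule {Scal \<zero>} R (zero_module R)"
  using module.carrier_is_submodule[OF module_reg] module.carrier_is_submodule[OF module_zero]
  by (simp_all add: reg_module_def zero_module_def)

lemma is_fcomplex_R: "is_fcomplex R (R_fc R p n)"
proof (rule is_fcomplexI)
  show "diff (R_fc R p n) m \<in> mod_hom R (cmod (R_fc R p n) m) (cmod (R_fc R p n) (m + 1))" for m
    by (auto simp: mod_hom_def R_fc_def reg_module_def zero_module_def)
  show "submodule (filt (R_fc R p n) q m) R (cmod (R_fc R p n) m)" for q m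
    using submodule_reg submodule_zero_reg by (auto simp: R_fc_def)
  show "module R (cmod (R_fc R p n) m)" for m
    using module_reg module_zero by (auto simp: R_fc_def)
qed (auto simp: R_fc_def reg_module_def zero_module_def split: if_splits)

lemma is_fcomplex_Z: "is_fcomplex R (Z_fc R k p n)"
proof (rule is_fcomplexI)
  show "diff (Z_fc R k p n) m \<in> mod_hom R (cmod (Z_fc R k p n) m) (cmod (Z_fc R k p n) (m + 1))"
    for m
    by (auto simp: mod_hom_def Z_fc_def reg_module_def zero_module_def)
  show "submodule (filt (Z_fc R k p n) q m) R (cmod (Z_fc R k p n) m)" for q m
    using submodule_reg submodule_zero_reg by (auto simp: Z_fc_def)
  show "module R (cmod (Z_fc R k p n) m)" for m
    using module_reg module_zero by (auto simp: Z_fc_def)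
qed (auto simp: Z_fc_def reg_module_def zero_module_def split: if_splits)

lemma submodule_sum:
  assumes "module R M" "module R N" "submodule H R M" "submodule K R N"
  shows "submodule {Couple x y | x y. x \<in> H \<and> y \<in> K} R (sum_module M N)"
proof -
  note H = module.submoduleE[OF assms(1,3)] and K = module.submoduleE[OF assms(2,4)]
  have inv: "\<ominus>\<^bsub>sum_module M N\<^esub> Couple x y = Couple (\<ominus>\<^bsub>M\<^esub> x) (\<ominus>\<^bsub>N\<^esub> y)"
    if "x \<in> carrier M" "y \<in> carrier N" for x y
  proof -
    interpret M: module R M by fact
    interpret N: module R N by fact
    interpret S: module R "sum_module M N" by (rule module_sum) fact+
    show ?thesis
      by (rule S.minus_equality) (use that in \<open>auto simp: sum_module_def M.l_neg N.l_neg\<close>)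
  qed
  show ?thesis
  proof (rule module.submoduleI[OF module_sum[OF assms(1,2)]], goal_cases)
    case 1 show ?case using H(1) K(1) by (auto simp: sum_module_def)
  next
    case 2 show ?case
      using subgroup.one_closed[OF submodule.axioms(1)[OF assms(3)]]
        subgroup.one_closed[OF submodule.axioms(1)[OF assms(4)]] by (auto simp: sum_module_def)
  next
    case (3 a)
    then obtain x y where "a = Couple x y" "x \<in> H" "y \<in> K" by auto
    moreover from this have "x \<in> carrier M" "y \<in> carrier N" using H(1) K(1) by auto
    ultimately show ?case using H(3) K(3) inv by simp
  next
    case 4 then show ?case using H K by (auto simp: sum_module_def)
  next
    case 5 then show ?case using H K by (auto simp: sum_module_def)
  qed
qed

lemma is_fcomplex_sum:
  assumes A: "is_fcomplex R A" and B: "is_fcomplex R B"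
  shows "is_fcomplex R (sum_fc A B)"
proof (rule is_fcomplexI)
  show "diff (sum_fc A B) m \<in> mod_hom R (cmod (sum_fc A B) m) (cmod (sum_fc A B) (m + 1))" for m
    using is_fcomplexD(2)[OF A, of m] is_fcomplexD(2)[OF B, of m]
    by (auto simp: mod_hom_def sum_fc_def sum_module_def)
  show "module R (cmod (sum_fc A B) m)" for m
    using is_fcomplexD(1)[OF A] is_fcomplexD(1)[OF B] by (simp add: sum_fc_def module_sum)
  show "submodule (filt (sum_fc A B) q m) R (cmod (sum_fc A B) m)" for q m
    using is_fcomplexD(1,4)[OF A] is_fcomplexD(1,4)[OF B]
    by (auto simp: sum_fc_def intro!: submodule_sum)
  show "diff (sum_fc A B) (m + 1) (diff (sum_fc A B) m x) = \<zero>\<^bsub>cmod (sum_fc A B) (m + 2)\<^esub>"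
    if x: "x \<in> carrier (cmod (sum_fc A B) m)" for m x
  proof -
    obtain a b where "x = Couple a b" "a \<in> carrier (cmod A m)" "b \<in> carrier (cmod B m)"
      using x by (auto simp: sum_fc_def sum_module_def)
    with is_fcomplexD(3)[OF A this(2)] is_fcomplexD(3)[OF B this(3)] show ?thesis
      by (simp add: sum_fc_def sum_module_def)
  qed
  show "diff (sum_fc A B) m x \<in> filt (sum_fc A B) q (m + 1)"
    and "x \<in> filt (sum_fc A B) (q + 1) m"
    if x: "x \<in> filt (sum_fc A B) q m" for q m x
  proof -
    obtain a b where "x = Couple a b" "a \<in> filt A q m" "b \<in> filt B q m"
      using x by (auto simp: sum_fc_def)
    with is_fcomplexD(5,6)[OF A this(2)] is_fcomplexD(5,6)[OF B this(3)]
    show "diff (sum_fc A B) m x \<in> filt (sum_fc A B) q (m + 1)"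
      and "x \<in> filt (sum_fc A B) (q + 1) m"
      by (simp_all add: sum_fc_def)
  qed
qed

lemma is_fcomplex_B: "is_fcomplex R (B_fc R k p n)"
  unfolding B_fc_def by (rule is_fcomplex_sum[OF is_fcomplex_Z is_fcomplex_Z])

lemma initial_map_arr:
  assumes X: "is_fcomplex R X"
  shows "initial_map R X \<in> arr R"
proof -
  have M: "module R (cmod X n)" for n
    using is_fcomplexD(1)[OF X] .
  have mon: "abelian_monoid (cmod X n)" for n
    using abelian_group.axioms(1)[OF module.axioms(2)[OF M]] .
  have z: "\<zero>\<^bsub>cmod X n\<^esub> \<in> carrier (cmod X n)"
      "\<zero>\<^bsub>cmod X n\<^esub> \<oplus>\<^bsub>cmod X n\<^esub> \<zero>\<^bsub>cmod X n\<^esub> = \<zero>\<^bsub>cmod X n\<^esub>" for n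
    using abelian_monoid.zero_closed[OF mon] abelian_monoid.l_zero[OF mon] by blast+
  have s: "a \<odot>\<^bsub>cmod X n\<^esub> \<zero>\<^bsub>cmod X n\<^esub> = \<zero>\<^bsub>cmod X n\<^esub>" if "a \<in> carrier R" for n a
    using module.smult_r_null[OF M that] .
  have d: "diff X n \<zero>\<^bsub>cmod X n\<^esub> = \<zero>\<^bsub>cmod X (n + 1)\<^esub>" for n
  proof -
    have h: "diff X n (\<zero> \<odot>\<^bsub>cmod X n\<^esub> \<zero>\<^bsub>cmod X n\<^esub>) = \<zero> \<odot>\<^bsub>cmod X (n + 1)\<^esub> diff X n \<zero>\<^bsub>cmod X n\<^esub>"
      and c: "diff X n \<zero>\<^bsub>cmod X n\<^esub> \<in> carrier (cmod X (n + 1))"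
      using is_fcomplexD(2)[OF X, of n] z(1)[of n] by (auto simp: mod_hom_def)
    show ?thesis
      using h unfolding s[OF zero_closed] module.smult_l_null[OF M c] .
  qed
  have f: "\<zero>\<^bsub>cmod X n\<^esub> \<in> filt X p n" for p n
    using subgroup.one_closed[OF submodule.axioms(1)[OF is_fcomplexD(4)[OF X]]] by simp
  have "fn (initial_map R X) n \<in> mod_hom R (cmod (zero_fc R) n) (cmod X n)" for n
    by (simp add: mod_hom_def initial_map_def z s)
  moreover have "src (initial_map R X) = zero_fc R" "tgt (initial_map R X) = X"
      "fn (initial_map R X) n x = \<zero>\<^bsub>cmod X n\<^esub>" for n x
    by (simp_all add: initial_map_def)
  ultimately show ?thesis
    unfolding arr_def using X is_fcomplex_zero d f by (simp add: image_subset_iff)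
qed

lemma phi_arr:
  assumes "k \<ge> 1"
  shows "(phi R k p n :: ('r, ('r, 'x) elt) fmor) \<in> arr R" (is "?f \<in> _")
proof -
  have st: "src ?f = Z_fc R k p n" "tgt ?f = B_fc R k p n"
    by (simp_all add: phi_def)
  have "fn ?f m \<in> mod_hom R (cmod (src ?f) m) (cmod (tgt ?f) m)" for m
    unfolding st
    by (auto simp: mod_hom_def phi_def Z_fc_def B_fc_def sum_fc_def sum_module_def
        reg_module_def zero_module_def)
  moreover have "fn ?f m ` filt (src ?f) q m \<subseteq> filt (tgt ?f) q m" for q m
    unfolding st using assms by (auto simp: phi_def Z_fc_def B_fc_def sum_fc_def of_nat_diff)
  moreover have "fn ?f (m + 1) (diff (src ?f) m x) = diff (tgt ?f) m (fn ?f m x)"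
    if "x \<in> carrier (cmod (src ?f) m)" for m x
    using that unfolding st
    by (auto simp: phi_def Z_fc_def B_fc_def sum_fc_def zero_module_def split: if_splits)
  moreover have "is_fcomplex R (src ?f)" "is_fcomplex R (tgt ?f)"
    unfolding st by (rule is_fcomplex_Z is_fcomplex_B)+
  ultimately show ?thesis
    unfolding arr_def by blast
qed

lemma generating_maps_arr: "I_S R r S \<subseteq> arr R" "J_S R S \<subseteq> arr R"
  by (auto simp: I_S_def I_r_def J_S_def J_k_def intro!: phi_arr initial_map_arr is_fcomplex_Z)

end

end

theory Submission
  imports Defs
begin

text \<open>
  Maps out of $R_{(0)}^0$ pick out cocycles of degree 0 and filtration 0. Let
  $\mathcal{Z}_\infty = (R_{(0)}^0 \to R)$ with the target $R$ in degree 1 lying in every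
  filtration level. The projection $\mathcal{Z}_\infty \to R_{(0)}^0$ has the right lifting
  property against \<open>I_S\<close>: in degree 0 source and target agree, and in degree 1 there
  is no filtration constraint left. But $1 \in R_{(0)}^0$ does not lift to a cocycle of
  $\mathcal{Z}_\infty$, so $0 \to R_{(0)}^0$ does not lift against this projection.
\<close>

section \<open>Linear maps and filtered morphisms on carriers\<close>

lemma mod_homD:
  assumes "f \<in> mod_hom R M N"
  shows "x \<in> carrier M \<Longrightarrow> f x \<in> carrier N"
    and "x \<in> carrier M \<Longrightarrow> y \<in> carrier M \<Longrightarrow> f (x \<oplus>\<^bsub>M\<^esub> y) = f x \<oplus>\<^bsub>N\<^esub> f y"
    and "a \<in> carrier R \<Longrightarrow> x \<in> carrier M \<Longrightarrow> f (a \<odot>\<^bsub>M\<^esub> x) = a \<odot>\<^bsub>N\<^esub> f x"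
  using assms by (auto simp: mod_hom_def)

lemma mod_hom_zero:
  assumes "module R M" "module R N" "f \<in> mod_hom R M N"
  shows "f \<zero>\<^bsub>M\<^esub> = \<zero>\<^bsub>N\<^esub>"
proof -
  interpret M: module R M by fact
  interpret N: module R N by fact
  have "f \<zero>\<^bsub>M\<^esub> = f (\<zero>\<^bsub>R\<^esub> \<odot>\<^bsub>M\<^esub> \<zero>\<^bsub>M\<^esub>)" by simp
  also have "\<dots> = \<zero>\<^bsub>R\<^esub> \<odot>\<^bsub>N\<^esub> f \<zero>\<^bsub>M\<^esub>" by (rule mod_homD(3)[OF assms(3)]) simp_all
  also have "\<dots> = \<zero>\<^bsub>N\<^esub>" using mod_homD(1)[OF assms(3)] by simp
  finally show ?thesis .
qed

lemma arrD:
  assumes "f \<in> arr R"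
  shows "is_fcomplex R (src f)" and "is_fcomplex R (tgt f)"
    and "fn f n \<in> mod_hom R (cmod (src f) n) (cmod (tgt f) n)"
    and "x \<in> carrier (cmod (src f) n) \<Longrightarrow>
      fn f (n + 1) (diff (src f) n x) = diff (tgt f) n (fn f n x)"
    and "x \<in> filt (src f) p n \<Longrightarrow> fn f n x \<in> filt (tgt f) p n"
  using assms by (auto simp: arr_def image_subset_iff)

lemma arr_zero:
  assumes "f \<in> arr R"
  shows "fn f n \<zero>\<^bsub>cmod (src f) n\<^esub> = \<zero>\<^bsub>cmod (tgt f) n\<^esub>"
  using arrD[OF assms] by (auto intro!: mod_hom_zero dest: is_fcomplexD(1))

section \<open>Components of the concrete modules, complexes and maps\<close>

lemma module_sel:
  "carrier (reg_module R) = Scal ` carrier R"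
  "carrier (zero_module R) = {Scal \<zero>\<^bsub>R\<^esub>}"
  "\<zero>\<^bsub>reg_module R\<^esub> = Scal \<zero>\<^bsub>R\<^esub>"
  "\<zero>\<^bsub>zero_module R\<^esub> = Scal \<zero>\<^bsub>R\<^esub>"
  "x \<oplus>\<^bsub>reg_module R\<^esub> y = Scal (the_scal x \<oplus>\<^bsub>R\<^esub> the_scal y)"
  "x \<oplus>\<^bsub>zero_module R\<^esub> y = Scal (the_scal x \<oplus>\<^bsub>R\<^esub> the_scal y)"
  "a \<odot>\<^bsub>reg_module R\<^esub> x = Scal (a \<otimes>\<^bsub>R\<^esub> the_scal x)"
  "a \<odot>\<^bsub>zero_module R\<^esub> x = Scal (a \<otimes>\<^bsub>R\<^esub> the_scal x)"
  by (simp_all add: reg_module_def zero_module_def)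

definition Z_inf_fc :: "'r ring \<Rightarrow> ('r, ('r, 'x) elt) fcomplex" where
  "Z_inf_fc R = Z_fc R 0 0 0 \<lparr>filt := \<lambda>q m. if m = 1 \<or> m = 0 \<and> 0 \<le> q
     then Scal ` carrier R else {Scal \<zero>\<^bsub>R\<^esub>}\<rparr>"

definition Z_inf_proj :: "'r ring \<Rightarrow> ('r, ('r, 'x) elt) fmor" where
  "Z_inf_proj R = \<lparr>src = Z_inf_fc R, tgt = R_fc R 0 0,
     fn = \<lambda>m x. if m = 0 then x else Scal \<zero>\<^bsub>R\<^esub>\<rparr>"

lemma Z_inf_sel:
  "cmod (Z_inf_fc R) m = (if m = 0 \<or> m = 1 then reg_module R else zero_module R)"
  "diff (Z_inf_fc R) m x = (if m = 0 then x else Scal \<zero>\<^bsub>R\<^esub>)"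
  "filt (Z_inf_fc R) q m = (if m = 1 \<or> m = 0 \<and> 0 \<le> q then Scal ` carrier R else {Scal \<zero>\<^bsub>R\<^esub>})"
  by (simp_all add: Z_inf_fc_def Z_fc_def)

lemma R_sel:
  "cmod (R_fc R p n) m = (if m = n then reg_module R else zero_module R)"
  "diff (R_fc R p n) m x = Scal \<zero>\<^bsub>R\<^esub>"
  "filt (R_fc R p n) q m = (if m = n \<and> p \<le> q then Scal ` carrier R else {Scal \<zero>\<^bsub>R\<^esub>})"
  by (simp_all add: R_fc_def)

lemma Z_sel:
  "cmod (Z_fc R k p n) m = (if m = n \<or> m = n + 1 then reg_module R else zero_module R)"
  "diff (Z_fc R k p n) m x = (if m = n then x else Scal \<zero>\<^bsub>R\<^esub>)"
  by (simp_all add: Z_fc_def)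

lemma sum_module_sel:
  "carrier (sum_module M N) = {Couple x y | x y. x \<in> carrier M \<and> y \<in> carrier N}"
  "\<zero>\<^bsub>sum_module M N\<^esub> = Couple \<zero>\<^bsub>M\<^esub> \<zero>\<^bsub>N\<^esub>"
  "Couple x y \<oplus>\<^bsub>sum_module M N\<^esub> Couple x' y' = Couple (x \<oplus>\<^bsub>M\<^esub> x') (y \<oplus>\<^bsub>N\<^esub> y')"
  "a \<odot>\<^bsub>sum_module M N\<^esub> Couple x y = Couple (a \<odot>\<^bsub>M\<^esub> x) (a \<odot>\<^bsub>N\<^esub> y)"
  by (simp_all add: sum_module_def)

text \<open>With the copairing below, this makes the map g in the case n = 1 of
  \<open>has_lift_phi\<close> linear.\<close>

lemma mod_hom_diff:
  assumes N: "module R N" and f: "f \<in> mod_hom R M N" and g: "g \<in> mod_hom R M N"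
  shows "(\<lambda>x. f x \<ominus>\<^bsub>N\<^esub> g x) \<in> mod_hom R M N"
proof -
  interpret N: module R N by fact
  show ?thesis
    unfolding mod_hom_def
  proof (intro CollectI conjI ballI funcsetI)
    fix x assume x: "x \<in> carrier M"
    note [simp] = mod_homD(1)[OF f] mod_homD(1)[OF g]
    show "f x \<ominus>\<^bsub>N\<^esub> g x \<in> carrier N"
      using x by simp
    show "f (x \<oplus>\<^bsub>M\<^esub> y) \<ominus>\<^bsub>N\<^esub> g (x \<oplus>\<^bsub>M\<^esub> y) = (f x \<ominus>\<^bsub>N\<^esub> g x) \<oplus>\<^bsub>N\<^esub> (f y \<ominus>\<^bsub>N\<^esub> g y)"
      if y: "y \<in> carrier M" for y
      unfolding mod_homD(2)[OF f x y] mod_homD(2)[OF g x y] a_minus_def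
      using x y by (simp add: N.minus_add N.a_ac)
    show "f (a \<odot>\<^bsub>M\<^esub> x) \<ominus>\<^bsub>N\<^esub> g (a \<odot>\<^bsub>M\<^esub> x) = a \<odot>\<^bsub>N\<^esub> (f x \<ominus>\<^bsub>N\<^esub> g x)"
      if a: "a \<in> carrier R" for a
      unfolding mod_homD(3)[OF f a x] mod_homD(3)[OF g a x] a_minus_def
      using x a by (simp add: N.smult_r_distr N.smult_r_minus)
  qed
qed

lemma mod_hom_copair:
  assumes L: "module R L" and f: "f \<in> mod_hom R M L" and g: "g \<in> mod_hom R N L"
  shows "(\<lambda>w. f (pfst w) \<oplus>\<^bsub>L\<^esub> g (psnd w)) \<in> mod_hom R (sum_module M N) L"
proof -
  interpret L: module R L by fact
  note [simp] = mod_homD(1)[OF f] mod_homD(1)[OF g]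
  show ?thesis
    unfolding mod_hom_def
    by (auto simp: sum_module_sel mod_homD(2,3)[OF f] mod_homD(2,3)[OF g]
        L.smult_r_distr L.a_ac)
qed

lemma B_sel:
  "cmod (B_fc R k p n) m =
    sum_module (if m = n - 1 \<or> m = n then reg_module R else zero_module R)
      (if m = n \<or> m = n + 1 then reg_module R else zero_module R)"
  "diff (B_fc R k p n) m (Couple x y) =
    Couple (if m = n - 1 then x else Scal \<zero>\<^bsub>R\<^esub>) (if m = n then y else Scal \<zero>\<^bsub>R\<^esub>)"
  by (simp_all add: B_fc_def sum_fc_def Z_sel)

lemma phi_sel:
  "src (phi R k p n) = Z_fc R k p n" "tgt (phi R k p n) = B_fc R k p n"
  "fn (phi R k p n) m x = (if m = n then Couple x x else Couple (Scal \<zero>\<^bsub>R\<^esub>) x)"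
  by (simp_all add: phi_def)

lemma initial_map_sel:
  "src (initial_map R X) = zero_fc R" "tgt (initial_map R X) = X"
  "fn (initial_map R X) m x = \<zero>\<^bsub>cmod X m\<^esub>"
  by (simp_all add: initial_map_def)

lemma Z_inf_proj_sel:
  "src (Z_inf_proj R) = Z_inf_fc R" "tgt (Z_inf_proj R) = R_fc R 0 0"
  "fn (Z_inf_proj R) m x = (if m = 0 then x else Scal \<zero>\<^bsub>R\<^esub>)"
  by (simp_all add: Z_inf_proj_def)

context
  fixes R :: "'r ring" (structure)
  assumes cring: "cring R"
begin

interpretation cring R by (rule cring)

section \<open>The projection to the unit and a criterion for lifting against it\<close>

lemma is_fcomplex_Z_inf: "is_fcomplex R (Z_inf_fc R)"
proof (rule is_fcomplexI)
  show "diff (Z_inf_fc R) m \<in> mod_hom R (cmod (Z_inf_fc R) m) (cmod (Z_inf_fc R) (m + 1))" for m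
    by (auto simp: mod_hom_def Z_inf_sel module_sel)
  show "submodule (filt (Z_inf_fc R) q m) R (cmod (Z_inf_fc R) m)" for q m
    using submodule_reg[OF cring] submodule_zero_reg[OF cring] by (auto simp: Z_inf_sel)
  show "module R (cmod (Z_inf_fc R) m)" for m
    using module_reg[OF cring] module_zero[OF cring] by (auto simp: Z_inf_sel)
qed (auto simp: Z_inf_sel module_sel split: if_splits)

lemma Z_inf_proj_arr: "Z_inf_proj R \<in> arr R"
  unfolding arr_def using is_fcomplex_Z_inf is_fcomplex_R[OF cring]
  by (auto simp: Z_inf_proj_sel Z_inf_sel R_sel mod_hom_def module_sel)

text \<open>Reduces a lift h to its component g in degree 1. In degree 0 the projection is the
  identity, which forces h = v; outside degrees 0 and 1 the module of \<open>Z_inf_fc R\<close> is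
  zero. In degree 1 the unit vanishes, so v imposes nothing there; what remains is that h commutes
  with the differential out of degree 0 and extends u.\<close>

lemma has_lift_Z_inf_projI:
  fixes i :: "('r, ('r, 'x) elt) fmor"
  assumes i: "i \<in> arr R"
    and ex: "\<And>u v :: ('r, ('r, 'x) elt) fmor. \<lbrakk>u \<in> arr R; v \<in> arr R;
      src u = src i; tgt u = Z_inf_fc R; src v = tgt i; tgt v = R_fc R 0 0;
      \<And>x. x \<in> carrier (cmod (src i) 0) \<Longrightarrow> fn u 0 x = fn v 0 (fn i 0 x)\<rbrakk> \<Longrightarrow>
      \<exists>g\<in>mod_hom R (cmod (tgt i) 1) (reg_module R).
        (\<forall>y\<in>carrier (cmod (tgt i) 0). g (diff (tgt i) 0 y) = fn v 0 y) \<and>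
        (\<forall>x\<in>carrier (cmod (src i) 1). g (fn i 1 x) = fn u 1 x)"
  shows "has_lift R i (Z_inf_proj R)"
  unfolding has_lift_def
proof (intro ballI impI, elim conjE)
  fix u v :: "('r, ('r, 'x) elt) fmor"
  assume u: "u \<in> arr R" and v: "v \<in> arr R"
    and su: "src u = src i" and "tgt u = src (Z_inf_proj R)"
    and sv: "src v = tgt i" and "tgt v = tgt (Z_inf_proj R)"
    and comm: "\<forall>n. \<forall>x\<in>carrier (cmod (src i) n). fn (Z_inf_proj R) n (fn u n x) = fn v n (fn i n x)"
  then have tu: "tgt u = Z_inf_fc R" and tv: "tgt v = R_fc R 0 0"
    by (simp_all add: Z_inf_proj_sel)
  have comm0: "fn u 0 x = fn v 0 (fn i 0 x)" if "x \<in> carrier (cmod (src i) 0)" for x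
    using comm[rule_format, OF that] by (simp add: Z_inf_proj_sel)
  obtain g where g: "g \<in> mod_hom R (cmod (tgt i) 1) (reg_module R)"
    and gd: "\<And>y. y \<in> carrier (cmod (tgt i) 0) \<Longrightarrow> g (diff (tgt i) 0 y) = fn v 0 y"
    and gi: "\<And>x. x \<in> carrier (cmod (src i) 1) \<Longrightarrow> g (fn i 1 x) = fn u 1 x"
    using ex[OF u v su tu sv tv comm0] by blast
  define h :: "('r, ('r, 'x) elt) fmor" where "h = \<lparr>src = tgt i, tgt = Z_inf_fc R,
    fn = \<lambda>m. if m = 0 then fn v 0 else if m = 1 then g else (\<lambda>_. Scal \<zero>)\<rparr>"
  have h_sel: "src h = tgt i" "tgt h = Z_inf_fc R"
    "fn h m = (if m = 0 then fn v 0 else if m = 1 then g else (\<lambda>_. Scal \<zero>))" for m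
    by (simp_all add: h_def)
  note B = arrD(2)[OF i]
  have filt_carrier: "x \<in> carrier (cmod (tgt i) n)" if "x \<in> filt (tgt i) p n" for x p n
    using module.submoduleE(1)[OF is_fcomplexD(1,4)[OF B]] that by blast
  have v0: "fn v 0 \<in> mod_hom R (cmod (tgt i) 0) (reg_module R)"
    using arrD(3)[OF v, of 0] by (simp add: sv tv R_sel)
  have "h \<in> arr R"
    unfolding arr_def
  proof (intro CollectI conjI allI ballI subsetI)
    show "fn h n \<in> mod_hom R (cmod (src h) n) (cmod (tgt h) n)" for n
      using v0 g by (auto simp: h_sel Z_inf_sel mod_hom_def module_sel)
    show "fn h (n + 1) (diff (src h) n x) = diff (tgt h) n (fn h n x)"
      if x: "x \<in> carrier (cmod (src h) n)" for n x
    proof -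
      \<comment> \<open>Degree 0 is the condition \<open>gd\<close>. In degree -1 boundaries must go
        to zero, which v ensures because the unit has zero differential. In all other degrees both
        sides are zero.\<close>
      consider "n = 0" | "n = -1" | "n \<noteq> 0" "n \<noteq> -1" by blast
      then show ?thesis
      proof cases
        case 1
        then show ?thesis using gd x by (simp add: h_sel Z_inf_sel)
      next
        case 2
        then show ?thesis using arrD(4)[OF v, of x n] x by (simp add: h_sel Z_inf_sel sv tv R_sel)
      qed (auto simp: h_sel Z_inf_sel)
    qed
    \<comment> \<open>In degree 0 the filtrations of \<open>Z_inf_fc R\<close> and of the unit
      agree, so v gives this; in degree 1 every level is all of R, so g only has to land in the
      carrier.\<close>
    show "y \<in> filt (tgt h) p n" if "y \<in> fn h n ` filt (src h) p n" for y p n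
      using that mod_homD(1)[OF g] filt_carrier arrD(5)[OF v, of _ p n]
      by (auto simp: h_sel Z_inf_sel sv tv R_sel module_sel)
  qed (simp_all add: h_sel B is_fcomplex_Z_inf)
  moreover have "fn h n (fn i n x) = fn u n x" if x: "x \<in> carrier (cmod (src i) n)" for n x
    using x comm0 gi mod_homD(1)[OF arrD(3)[OF u], of x n]
    by (auto simp: h_sel su tu Z_inf_sel module_sel)
  moreover have "fn (Z_inf_proj R) n (fn h n y) = fn v n y"
    if y: "y \<in> carrier (cmod (tgt i) n)" for n y
    using y mod_homD(1)[OF arrD(3)[OF v], of y n]
    by (auto simp: h_sel Z_inf_proj_sel sv tv R_sel module_sel)
  ultimately show "\<exists>h\<in>arr R. src h = tgt i \<and> tgt h = src (Z_inf_proj R) \<and>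
      (\<forall>n. \<forall>x\<in>carrier (cmod (src i) n). fn h n (fn i n x) = fn u n x) \<and>
      (\<forall>n. \<forall>y\<in>carrier (cmod (tgt i) n). fn (Z_inf_proj R) n (fn h n y) = fn v n y)"
    by (intro bexI[of _ h]) (auto simp: h_sel Z_inf_proj_sel)
qed

section \<open>Lifting against the generating maps\<close>

lemma boundary_to_R:
  assumes v: "v \<in> arr R" and "tgt v = R_fc R 0 0" and "y \<in> carrier (cmod (src v) (- 1))"
  shows "fn v 0 (diff (src v) (- 1) y) = Scal \<zero>"
  using arrD(4)[OF v assms(3)] by (simp add: assms(2) R_sel)

lemma zero_hom: "(\<lambda>_. Scal \<zero>) \<in> mod_hom R M (reg_module R)"
  by (simp add: mod_hom_def module_sel)

text \<open>For n = 0 the differential out of degree 0 is the identity of R, so g = v in degree 0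
  works. For n = -1 every element of degree 0 is a boundary, and for other n only zero is left
  there; either way v vanishes in degree 0 and g = 0 works.\<close>

lemma has_lift_initial_Z:
  "has_lift R (initial_map R (Z_fc R k p n) :: ('r, ('r, 'x) elt) fmor) (Z_inf_proj R)"
  (is "has_lift R ?i _")
proof (rule has_lift_Z_inf_projI)
  show "?i \<in> arr R" by (rule initial_map_arr[OF cring is_fcomplex_Z[OF cring]])
  fix u v :: "('r, ('r, 'x) elt) fmor"
  assume u: "u \<in> arr R" and v: "v \<in> arr R"
    and "src u = src ?i" and tu: "tgt u = Z_inf_fc R"
    and "src v = tgt ?i" and tv: "tgt v = R_fc R 0 0"
  then have su: "src u = zero_fc R" and sv: "src v = Z_fc R k p n"
    by (simp_all add: initial_map_def)
  have u1: "fn u 1 (Scal \<zero>) = Scal \<zero>"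
    using arr_zero[OF u, of 1] by (simp add: su tu zero_fc_def Z_inf_sel module_sel)
  have v00: "fn v 0 (Scal \<zero>) = Scal \<zero>"
    using arr_zero[OF v, of 0] by (simp add: sv tv R_sel Z_sel module_sel split: if_splits)
  show "\<exists>g\<in>mod_hom R (cmod (tgt ?i) 1) (reg_module R).
      (\<forall>y\<in>carrier (cmod (tgt ?i) 0). g (diff (tgt ?i) 0 y) = fn v 0 y) \<and>
      (\<forall>x\<in>carrier (cmod (src ?i) 1). g (fn ?i 1 x) = fn u 1 x)"
  proof (cases "n = 0")
    case True
    then show ?thesis
      using arrD(3)[OF v, of 0] u1 v00
      by (intro bexI[of _ "fn v 0"]) (auto simp: initial_map_sel sv tv R_sel Z_sel zero_fc_def module_sel)
  next
    case False
    have "fn v 0 y = Scal \<zero>" if "y \<in> carrier (cmod (Z_fc R k p n) 0)" for y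
    proof (cases "n = - 1")
      case True
      then show ?thesis using boundary_to_R[OF v tv, of y] that by (simp add: sv Z_sel)
    next
      case n: False
      then show ?thesis using that v00 False by (auto simp: Z_sel module_sel split: if_splits)
    qed
    then show ?thesis
      using u1
      by (intro bexI[of _ "\<lambda>_. Scal \<zero>"]) (auto simp: initial_map_sel zero_fc_def module_sel intro!: zero_hom)
  qed
qed

lemma has_lift_phi:
  assumes "k \<ge> 1"
  shows "has_lift R (phi R k p n :: ('r, ('r, 'x) elt) fmor) (Z_inf_proj R)"
  (is "has_lift R ?i _")
proof (rule has_lift_Z_inf_projI)
  show "?i \<in> arr R" by (rule phi_arr[OF cring assms])
  fix u v :: "('r, ('r, 'x) elt) fmor"
  assume u: "u \<in> arr R" and v: "v \<in> arr R"
    and "src u = src ?i" and tu: "tgt u = Z_inf_fc R"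
    and "src v = tgt ?i" and tv: "tgt v = R_fc R 0 0"
    and comm: "\<And>x. x \<in> carrier (cmod (src ?i) 0) \<Longrightarrow> fn u 0 x = fn v 0 (fn ?i 0 x)"
  then have su: "src u = Z_fc R k p n" and sv: "src v = B_fc R k p n"
    by (simp_all add: phi_sel)
  have v00: "fn v 0 (Couple (Scal \<zero>) (Scal \<zero>)) = Scal \<zero>"
    using arr_zero[OF v, of 0] by (simp add: sv tv R_sel B_sel sum_module_sel module_sel split: if_splits)
  have u1: "fn u 1 (Scal \<zero>) = Scal \<zero>"
    using arr_zero[OF u, of 1] by (simp add: su tu Z_sel Z_inf_sel module_sel split: if_splits)
  note uh = arrD(3)[OF u, of 1, unfolded su tu]
  note vh = arrD(3)[OF v, of 0, unfolded sv tv]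
  show "\<exists>g\<in>mod_hom R (cmod (tgt ?i) 1) (reg_module R).
      (\<forall>y\<in>carrier (cmod (tgt ?i) 0). g (diff (tgt ?i) 0 y) = fn v 0 y) \<and>
      (\<forall>x\<in>carrier (cmod (src ?i) 1). g (fn ?i 1 x) = fn u 1 x)"
  proof -
    consider "n = 0" | "n = 1" | "n = - 1" | "n \<noteq> 0" "n \<noteq> 1" "n \<noteq> - 1" by blast
    then show ?thesis
    proof cases
      case 1
      \<comment> \<open>Here d(a,b) = (0,b), so g(0,b) must equal both v(a,b) and u(b). They agree
        because (b,b) = (a,b) + (b-a,0), where (b-a,0) is a boundary and so is killed by v, while v
        on the diagonal is u.\<close>
      have "fn u 1 (Scal b) = fn v 0 (Couple (Scal a) (Scal b))"
        if ab: "a \<in> carrier R" "b \<in> carrier R" for a b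
      proof -
        have bd: "fn v 0 (Couple (Scal c) (Scal \<zero>)) = Scal \<zero>" if "c \<in> carrier R" for c
          using boundary_to_R[OF v tv, of "Couple (Scal c) (Scal \<zero>)"] that 1
          by (simp add: sv B_sel sum_module_sel module_sel)
        have "fn u 1 (Scal b) = fn u 0 (Scal b)"
          using arrD(4)[OF u, of "Scal b" 0] ab 1 by (simp add: su tu Z_sel Z_inf_sel module_sel)
        also have "\<dots> = fn v 0 (Couple (Scal b) (Scal b))"
          using comm[of "Scal b"] ab 1 by (simp add: phi_sel Z_sel module_sel)
        also have "Couple (Scal b) (Scal b) =
            Couple (Scal a) (Scal b) \<oplus>\<^bsub>cmod (B_fc R k p n) 0\<^esub> Couple (Scal (b \<ominus> a)) (Scal \<zero>)"
          using ab 1 by (simp add: B_sel sum_module_sel module_sel) algebra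
        also have "fn v 0 \<dots> = fn v 0 (Couple (Scal a) (Scal b)) \<oplus>\<^bsub>reg_module R\<^esub>
            fn v 0 (Couple (Scal (b \<ominus> a)) (Scal \<zero>))"
          using mod_homD(2)[OF vh, of "Couple (Scal a) (Scal b)"
            "Couple (Scal (b \<ominus> a)) (Scal \<zero>)"] ab 1
          by (simp add: B_sel sum_module_sel module_sel R_sel)
        also have "\<dots> = fn v 0 (Couple (Scal a) (Scal b))"
          using mod_homD(1)[OF vh, of "Couple (Scal a) (Scal b)"] ab 1
          by (auto simp: bd B_sel sum_module_sel module_sel R_sel)
        finally show ?thesis .
      qed
      \<comment> \<open>In degree n + 1 = 1 the first summand is zero, so g can read off the second
        coordinate.\<close>
      moreover have "(\<lambda>w. fn u 1 (psnd w)) \<in> mod_hom R (cmod (B_fc R k p n) 1) (reg_module R)"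
        using uh 1 unfolding mod_hom_def B_sel by (auto simp: sum_module_sel Z_sel Z_inf_sel module_sel)
      ultimately show ?thesis
        using 1 by (intro bexI[of _ "\<lambda>w. fn u 1 (psnd w)"])
          (auto simp: phi_sel B_sel sum_module_sel module_sel Z_sel)
    next
      case 2
      \<comment> \<open>\<open>v\<close> prescribes \<open>g\<close> on the boundaries \<open>(x, 0)\<close> and \<open>u\<close> on the diagonal \<open>(x, x)\<close>.\<close>
      let ?v = "\<lambda>x. fn v 0 (Couple x (Scal \<zero>))"
      have vR: "?v \<in> mod_hom R (reg_module R) (reg_module R)"
        unfolding mod_hom_def
      proof (intro CollectI conjI ballI)
        show "?v \<in> carrier (reg_module R) \<rightarrow> carrier (reg_module R)"
          using mod_homD(1)[OF vh] 2 by (force simp: B_sel sum_module_sel module_sel R_sel)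
        show "?v (x \<oplus>\<^bsub>reg_module R\<^esub> y) = ?v x \<oplus>\<^bsub>reg_module R\<^esub> ?v y"
          if "x \<in> carrier (reg_module R)" "y \<in> carrier (reg_module R)" for x y
          using mod_homD(2)[OF vh, of "Couple x (Scal \<zero>)" "Couple y (Scal \<zero>)"] that 2
          by (simp add: B_sel sum_module_sel module_sel R_sel)
        show "?v (a \<odot>\<^bsub>reg_module R\<^esub> x) = a \<odot>\<^bsub>reg_module R\<^esub> ?v x"
          if "a \<in> carrier R" "x \<in> carrier (reg_module R)" for a x
          using mod_homD(3)[OF vh, of a "Couple x (Scal \<zero>)"] that 2
          by (simp add: B_sel sum_module_sel module_sel R_sel)
      qed
      have uR: "fn u 1 \<in> mod_hom R (reg_module R) (reg_module R)"
        using uh 2 by (simp add: Z_sel Z_inf_sel)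
      \<comment> \<open>The decomposition (a,b) = (a-b,0) + (b,b) forces g(a,b) = v(a,0) - v(b,0) +
        u(b).\<close>
      define g where
        "g w = ?v (pfst w) \<oplus>\<^bsub>reg_module R\<^esub> (fn u 1 (psnd w) \<ominus>\<^bsub>reg_module R\<^esub> ?v (psnd w))" for w
      interpret N: module R "reg_module R :: ('r, ('r, 'x) elt) module" by (rule module_reg[OF cring])
      note vR' = mod_homD[OF vR] and uR' = mod_homD[OF uR]
      have "g \<in> mod_hom R (sum_module (reg_module R) (reg_module R)) (reg_module R)"
        unfolding g_def
        using mod_hom_copair[OF N.module_axioms vR mod_hom_diff[OF N.module_axioms uR vR]] .
      moreover have "g (Couple x (Scal \<zero>)) = ?v x" if "x \<in> carrier (reg_module R)" for x
        using N.r_neg[OF N.zero_closed] N.r_zero[OF vR'(1)[OF that]]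
        unfolding g_def elt.sel u1 v00 a_minus_def module_sel(3) by simp
      moreover have "g (Couple x x) = fn u 1 x" if "x \<in> carrier (reg_module R)" for x
      proof -
        have "g (Couple x x) = fn u 1 x \<oplus>\<^bsub>reg_module R\<^esub> (?v x \<ominus>\<^bsub>reg_module R\<^esub> ?v x)"
          unfolding g_def elt.sel a_minus_def
          by (intro N.a_lcomm N.a_inv_closed vR'(1) uR'(1) that)
        then show ?thesis
          unfolding a_minus_def N.r_neg[OF vR'(1)[OF that]] N.r_zero[OF uR'(1)[OF that]] .
      qed
      ultimately show ?thesis
        using 2 by (intro bexI[of _ g]) (auto simp: phi_sel B_sel sum_module_sel Z_sel module_sel(2,4))
    next
      case 3
      \<comment> \<open>Degree 0 is now the top degree n + 1, where y = (0,b) is the boundary of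
        (0,b) in degree -1.\<close>
      have "fn v 0 y = Scal \<zero>" if "y \<in> carrier (cmod (B_fc R k p n) 0)" for y
        using boundary_to_R[OF v tv, of y] boundary_to_R[OF v tv, of "Couple (Scal \<zero>) (psnd y)"] that 3
        by (auto simp: sv B_sel sum_module_sel module_sel)
      then show ?thesis
        using 3 u1
        by (intro bexI[of _ "\<lambda>_. Scal \<zero>"]) (auto simp: phi_sel Z_sel module_sel intro!: zero_hom)
    next
      case 4
      \<comment> \<open>For these n both summands vanish in degree 0.\<close>
      have "fn v 0 y = Scal \<zero>" if "y \<in> carrier (cmod (B_fc R k p n) 0)" for y
        using that 4 v00 by (auto simp: B_sel sum_module_sel module_sel split: if_splits)
      then show ?thesis
        using 4 u1
        by (intro bexI[of _ "\<lambda>_. Scal \<zero>"]) (auto simp: phi_sel Z_sel module_sel intro!: zero_hom)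
    qed
  qed
qed

section \<open>The right lifting property and the obstruction for the unit\<close>

lemma Z_inf_proj_rlp: "(Z_inf_proj R :: ('r, ('r, 'x) elt) fmor) \<in> rlp R (I_S R r S)"
  using Z_inf_proj_arr has_lift_initial_Z has_lift_phi[of "r + 1"]
  by (auto simp: rlp_def I_S_def I_r_def J_S_def J_k_def)

text \<open>The lifting problem is the identity of the unit, so a lift would be a section of the
  projection. The zero ring has to be excluded: over it every module is zero and the unit is
  cofibrant.\<close>

lemma no_lift_unit:
  assumes "\<one> \<noteq> \<zero>"
  shows "\<not> has_lift R (initial_map R (R_fc R 0 0) :: ('r, ('r, 'x) elt) fmor) (Z_inf_proj R)"
  (is "\<not> has_lift R ?i _")
proof
  assume lift: "has_lift R ?i (Z_inf_proj R)"
  let ?u = "initial_map R (Z_inf_fc R) :: ('r, ('r, 'x) elt) fmor"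
  let ?v = "\<lparr>src = R_fc R 0 0, tgt = R_fc R 0 0, fn = \<lambda>_ x. x\<rparr> :: ('r, ('r, 'x) elt) fmor"
  have "?u \<in> arr R" by (rule initial_map_arr[OF cring is_fcomplex_Z_inf])
  moreover have "?v \<in> arr R"
    using is_fcomplex_R[OF cring] by (auto simp: arr_def mod_hom_def R_sel)
  ultimately have "\<exists>h\<in>arr R. src h = tgt ?i \<and> tgt h = src (Z_inf_proj R) \<and>
      (\<forall>n. \<forall>x\<in>carrier (cmod (src ?i) n). fn h n (fn ?i n x) = fn ?u n x) \<and>
      (\<forall>n. \<forall>y\<in>carrier (cmod (tgt ?i) n). fn (Z_inf_proj R) n (fn h n y) = fn ?v n y)"
    using lift unfolding has_lift_def
    by (elim ballE[of _ _ ?u] ballE[of _ _ ?v] impE)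
      (auto simp: initial_map_def Z_inf_proj_sel Z_inf_sel R_sel module_sel)
  then obtain h where h: "h \<in> arr R" "src h = R_fc R 0 0" "tgt h = Z_inf_fc R"
    and "\<And>n y. y \<in> carrier (cmod (tgt ?i) n) \<Longrightarrow> fn (Z_inf_proj R) n (fn h n y) = fn ?v n y"
    unfolding initial_map_sel Z_inf_proj_sel by blast
  note lift = this(4)[of _ 0]
  have "fn h 0 (Scal \<one>) = Scal \<one>"
    using lift by (simp add: initial_map_sel Z_inf_proj_sel R_sel module_sel)
  \<comment> \<open>This is h(d 1) = d(h 1): the differential is zero in the unit but the identity
    out of degree 0 of \<open>Z_inf_fc R\<close>.\<close>
  moreover have "fn h 1 (Scal \<zero>) = fn h 0 (Scal \<one>)"
    using arrD(4)[OF h(1), of "Scal \<one>" 0] by (simp add: h R_sel Z_inf_sel module_sel)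
  moreover have "fn h 1 (Scal \<zero>) = Scal \<zero>"
    using arr_zero[OF h(1), of 1] by (simp add: h R_sel Z_inf_sel module_sel)
  ultimately show False using assms by simp
qed

end

theorem lemma5p1p7:
  fixes R :: "'r ring" and r :: nat and S :: "nat set"
  assumes "cring R" and "\<one>\<^bsub>R\<^esub> \<noteq> \<zero>\<^bsub>R\<^esub>"
    and "S \<subseteq> {0..r}" and "r \<in> S"
  shows "\<not> cofibrant R (fC_model R r S) (R_fc R 0 0 :: ('r, ('r, 'x) elt) fcomplex)"
  using Z_inf_proj_rlp[OF assms(1)] no_lift_unit[OF assms(1,2)]
  by (auto simp: cofibrant_def fC_model_def cofib_generated_def llp_def)

end
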